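(* Let $(X,b)$ be an arbitrary connected weighted graph and let $\Omega$ be a proper subset of $X$. Then $$c_P^\Omega=\mathrm{Inr}_{r_\Omega}(\Omega)=\mathrm{diam}_{r_\Omega}(X)$$ (as elements of $[0,\infty]$). In particular, there exists $c>0$ with $\|f\|_\infty^2\le c\,\mathcal E(f)$ for all $f\in\mathcal D$ with $\mathrm{supp}(f)\subset\Omega$ if and only if the inradius of $\Omega$ with respect to $r_\Omega$ is finite.
   Context: A weighted graph $(X,b)$ consists of a nonempty countable (finite or infinite) set $X$ and a symmetric function $b:X\times X\to[0,\infty)$ with $b(x,x)=0$ for all $x\in X$ (no summability or local finiteness is assumed). It is connected if for any $x,y\in X$ there are $x=x_0,x_1,\dots,x_k=y$ with $b(x_j,x_{j+1})>0$ for $0\le j<k$. Let $\mathcal D=\{f:X\to\mathbb R\mid \sum_{x,y\in X}b(x,y)|f(x)-f(y)|^2<\infty\}$ and $\mathcal E(f)=\frac12\sum_{x,y\in X}b(x,y)(f(x)-f(y))^2$ for $f\in\mathcal D$. $\mathrm{supp}(f)=\{x\mid f(x)\ne0\}$, $\|f\|_\infty=\sup_{x\in X}|f(x)|$. $c_P^\Omega\in[0,\infty]$ is the best constant $c$ (infimum of all admissible $c$) such that $\|f\|_\infty^2\le c\,\mathcal E(f)$ for all $f\in\mathcal D$ with $\mathrm{supp}(f)\subset\Omega$, with $c_P^\Omega=\infty$ if there is no such constant. $r_\Omega(x,y)=\sup\{|f(x)-f(y)|^2\mid f\in\mathcal D,\ f\ge0,\ \mathrm{supp}(f)\subset\Omega,\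 \mathcal E(f)\le1\}$ for $x,y\in X$; this is a pseudometric on $X$. For a pseudometric $\delta$ on $X$: $U_s(x)=\{y\in X\mid\delta(x,y)<s\}$, $\mathrm{Inr}_\delta(\Omega)=\sup\{s>0\mid\exists x\in\Omega:\ U_s(x)\subset\Omega\}$ (with $\sup\emptyset=0$), $\mathrm{diam}_\delta(X)=\sup_{x,y\in X}\delta(x,y)$. *)

theory Defs
  imports "HOL-Analysis.Analysis"
begin

text \<open>The vertex set is a carrier set \<open>X\<close>; only the values on \<open>X\<close> of vertex functions
  \<open>f :: 'v \<Rightarrow> real\<close> and edge weights \<open>b\<close> enter the definitions below.\<close>

definition weighted_graph :: "'v set \<Rightarrow> ('v \<Rightarrow> 'v \<Rightarrow> real) \<Rightarrow> bool" where
  "weighted_graph X b \<longleftrightarrow> X \<noteq> {} \<and> countable X \<and>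
     (\<forall>x\<in>X. \<forall>y\<in>X. 0 \<le> b x y) \<and> (\<forall>x\<in>X. \<forall>y\<in>X. b x y = b y x) \<and> (\<forall>x\<in>X. b x x = 0)"

definition connected_graph :: "'v set \<Rightarrow> ('v \<Rightarrow> 'v \<Rightarrow> real) \<Rightarrow> bool" where
  "connected_graph X b \<longleftrightarrow> (\<forall>x\<in>X. \<forall>y\<in>X. \<exists>(k::nat) (p::nat \<Rightarrow> 'v).
     p 0 = x \<and> p k = y \<and> (\<forall>j\<le>k. p j \<in> X) \<and> (\<forall>j<k. 0 < b (p j) (p (Suc j))))"

definition finite_energy :: "'v set \<Rightarrow> ('v \<Rightarrow> 'v \<Rightarrow> real) \<Rightarrow> ('v \<Rightarrow> real) set" where
  "finite_energy X b = {f. (\<lambda>(x, y). b x y * \<bar>f x - f y\<bar>\<^sup>2) summable_on X \<times> X}"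

text \<open>Meaningful on \<open>finite_energy\<close> only, since \<open>infsum\<close> is \<open>0\<close> for non-summable families.\<close>

definition energy :: "'v set \<Rightarrow> ('v \<Rightarrow> 'v \<Rightarrow> real) \<Rightarrow> ('v \<Rightarrow> real) \<Rightarrow> real" where
  "energy X b f = (1/2) * (\<Sum>\<^sub>\<infinity>(x, y)\<in>X \<times> X. b x y * (f x - f y)\<^sup>2)"

definition supp :: "'v set \<Rightarrow> ('v \<Rightarrow> real) \<Rightarrow> 'v set" where
  "supp X f = {x \<in> X. f x \<noteq> 0}"

text \<open>Functions in the energy space may be unbounded, so the supremum is taken in \<open>[0, \<infinity>]\<close>.\<close>

definition sup_norm :: "'v set \<Rightarrow> ('v \<Rightarrow> real) \<Rightarrow> ennreal" where
  "sup_norm X f = (SUP x\<in>X. ennreal \<bar>f x\<bar>)"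

text \<open>The infimum of the empty set is \<open>\<infinity>\<close> in \<open>ennreal\<close>.\<close>

definition poincare_const :: "'v set \<Rightarrow> ('v \<Rightarrow> 'v \<Rightarrow> real) \<Rightarrow> 'v set \<Rightarrow> ennreal" where
  "poincare_const X b \<Omega> = Inf (ennreal ` {c::real. 0 \<le> c \<and>
     (\<forall>f\<in>finite_energy X b. supp X f \<subseteq> \<Omega> \<longrightarrow> (sup_norm X f)\<^sup>2 \<le> ennreal (c * energy X b f))})"

text \<open>A pseudometric takes finite values. The supremum below is formed in \<open>[0, \<infinity>]\<close>, so that
  finiteness is not built into the definition.\<close>

definition r_dist :: "'v set \<Rightarrow> ('v \<Rightarrow> 'v \<Rightarrow> real) \<Rightarrow> 'v set \<Rightarrow> 'v \<Rightarrow> 'v \<Rightarrow> ennreal" where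
  "r_dist X b \<Omega> x y = (SUP f\<in>{f \<in> finite_energy X b.
     (\<forall>z\<in>X. 0 \<le> f z) \<and> supp X f \<subseteq> \<Omega> \<and> energy X b f \<le> 1}. ennreal (\<bar>f x - f y\<bar>\<^sup>2))"

definition pball :: "'v set \<Rightarrow> ('v \<Rightarrow> 'v \<Rightarrow> ennreal) \<Rightarrow> real \<Rightarrow> 'v \<Rightarrow> 'v set" where
  "pball X \<delta> s x = {y \<in> X. \<delta> x y < ennreal s}"

text \<open>The supremum of the empty set is \<open>0\<close> in \<open>ennreal\<close>.\<close>

definition inradius :: "'v set \<Rightarrow> ('v \<Rightarrow> 'v \<Rightarrow> ennreal) \<Rightarrow> 'v set \<Rightarrow> ennreal" where
  "inradius X \<delta> \<Omega> = Sup (ennreal ` {s::real. 0 < s \<and> (\<exists>x\<in>\<Omega>. pball X \<delta> s x \<subseteq> \<Omega>)})"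

definition pdiam :: "'v set \<Rightarrow> ('v \<Rightarrow> 'v \<Rightarrow> ennreal) \<Rightarrow> ennreal" where
  "pdiam X \<delta> = (SUP x\<in>X. SUP y\<in>X. \<delta> x y)"

end

theory Submission
  imports Defs
begin

text \<open>Every quantity is governed by the values \<open>r\<^sub>\<Omega>(x, y)\<close> with \<open>x \<in> \<Omega>\<close> and
  \<open>y \<notin> \<Omega>\<close>: all competitors vanish at \<open>y\<close>, so such a value is the best constant in
  \<open>(f x)\<^sup>2 \<le> c E(f)\<close>, whichever \<open>y\<close> is taken, and a ball around \<open>x\<close> stays inside \<open>\<Omega>\<close> exactly
  when its radius does not exceed this value. Replacing \<open>f\<close> by \<open>\<bar>f\<bar> / sqrt (E f)\<close>
  turns an arbitrary function supported in \<open>\<Omega>\<close> into a competitor; the case \<open>E f = 0\<close> is harmless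
  because connectedness forces \<open>f\<close> to be constant, hence zero. Conversely, for nonnegative
  \<open>f\<close> the oscillation \<open>\<bar>f x - f y\<bar>\<close> is at most the sup norm.\<close>

text \<open>Bridge between the \<open>ennreal\<close>-valued sup norm and pointwise real estimates.
  Nonnegativity of \<open>t\<close> matters because \<open>ennreal\<close> sends negative reals to
  0.\<close>

lemma sup_norm_power2_le_iff:
  assumes "0 \<le> t"
  shows "(sup_norm X f)\<^sup>2 \<le> ennreal t \<longleftrightarrow> (\<forall>x\<in>X. (f x)\<^sup>2 \<le> t)"
proof
  assume *: "(sup_norm X f)\<^sup>2 \<le> ennreal t"
  show "\<forall>x\<in>X. (f x)\<^sup>2 \<le> t"
  proof
    fix x assume "x \<in> X"
    then have "ennreal \<bar>f x\<bar> \<le> sup_norm X f"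
      unfolding sup_norm_def by (rule SUP_upper)
    then have "(ennreal \<bar>f x\<bar>)\<^sup>2 \<le> ennreal t"
      using * power_mono[of "ennreal \<bar>f x\<bar>" "sup_norm X f" 2] by (meson order_trans zero_le)
    then show "(f x)\<^sup>2 \<le> t"
      using assms by (simp add: ennreal_power)
  qed
next
  assume *: "\<forall>x\<in>X. (f x)\<^sup>2 \<le> t"
  have "sup_norm X f \<le> ennreal (sqrt t)"
    unfolding sup_norm_def using * by (intro SUP_least ennreal_leI real_le_rsqrt) simp
  then have "(sup_norm X f)\<^sup>2 \<le> (ennreal (sqrt t))\<^sup>2"
    by (intro power_mono) auto
  also have "\<dots> = ennreal t"
    using assms by (simp add: ennreal_power)
  finally show "(sup_norm X f)\<^sup>2 \<le> ennreal t" .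
qed

context
  fixes X :: "'v set" and b :: "'v \<Rightarrow> 'v \<Rightarrow> real"
  assumes weighted: "weighted_graph X b"
begin

lemma weight_nonneg: "x \<in> X \<Longrightarrow> y \<in> X \<Longrightarrow> 0 \<le> b x y"
  using weighted by (simp add: weighted_graph_def)

lemma finite_energyD:
  "f \<in> finite_energy X b \<Longrightarrow> (\<lambda>(x, y). b x y * (f x - f y)\<^sup>2) summable_on X \<times> X"
  by (simp add: finite_energy_def)

lemma energy_nonneg: "0 \<le> energy X b f"
  unfolding energy_def by (auto intro!: infsum_nonneg mult_nonneg_nonneg weight_nonneg)

text \<open>One term of a nonnegative sum is at most the sum; the 2 cancels the factor 1/2 in
  \<open>energy\<close>.\<close>

lemma edge_le_energy:
  assumes "f \<in> finite_energy X b" "x \<in> X" "y \<in> X"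
  shows "b x y * (f x - f y)\<^sup>2 \<le> 2 * energy X b f"
proof -
  have "sum (\<lambda>(x, y). b x y * (f x - f y)\<^sup>2) {(x, y)}
      \<le> (\<Sum>\<^sub>\<infinity>(x, y)\<in>X \<times> X. b x y * (f x - f y)\<^sup>2)"
    using assms by (intro finite_sum_le_infsum finite_energyD) (auto simp: weight_nonneg)
  then show ?thesis
    by (simp add: energy_def)
qed

text \<open>Termwise comparison of the two sums. Membership has to be proved as well, since
  \<open>infsum\<close> is 0 on a non-summable family and the energy bound alone would say
  little.\<close>

lemma finite_energy_contraction:
  assumes f: "f \<in> finite_energy X b"
    and lip: "\<And>x y. x \<in> X \<Longrightarrow> y \<in> X \<Longrightarrow> \<bar>g x - g y\<bar> \<le> a * \<bar>f x - f y\<bar>"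
  shows "g \<in> finite_energy X b" and "energy X b g \<le> a\<^sup>2 * energy X b f"
proof -
  let ?F = "\<lambda>(x, y). b x y * (f x - f y)\<^sup>2" and ?G = "\<lambda>(x, y). b x y * (g x - g y)\<^sup>2"
  have le: "?G z \<le> a\<^sup>2 * ?F z" if "z \<in> X \<times> X" for z
  proof -
    obtain x y where z: "z = (x, y)" "x \<in> X" "y \<in> X"
      using \<open>z \<in> X \<times> X\<close> by auto
    have "(g x - g y)\<^sup>2 \<le> (a * \<bar>f x - f y\<bar>)\<^sup>2"
      using power_mono[OF lip[of x y], of 2] z by simp
    then have "b x y * (g x - g y)\<^sup>2 \<le> b x y * (a\<^sup>2 * (f x - f y)\<^sup>2)"
      using z by (intro mult_left_mono weight_nonneg) (auto simp: power_mult_distrib)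
    then show ?thesis
      using z by (simp add: algebra_simps)
  qed
  have F: "(\<lambda>z. a\<^sup>2 * ?F z) summable_on X \<times> X"
    using finite_energyD[OF f] by (rule summable_on_cmult_right)
  have G: "?G summable_on X \<times> X"
    using F by (rule summable_on_comparison_test) (use le weight_nonneg in auto)
  then show "g \<in> finite_energy X b"
    by (simp add: finite_energy_def)
  have "infsum ?G (X \<times> X) \<le> (\<Sum>\<^sub>\<infinity>z\<in>X \<times> X. a\<^sup>2 * ?F z)"
    using G F le by (rule infsum_mono)
  also have "\<dots> = a\<^sup>2 * infsum ?F (X \<times> X)"
    by (rule infsum_cmult_right')
  finally show "energy X b g \<le> a\<^sup>2 * energy X b f"
    by (simp add: energy_def)
qed

text \<open>With zero energy no single edge term can be positive, so \<open>f\<close> does not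
  change along the edges of a path.\<close>

lemma energy_zero_const:
  assumes conn: "connected_graph X b" and f: "f \<in> finite_energy X b"
    and zero: "energy X b f = 0" and xy: "x \<in> X" "y \<in> X"
  shows "f x = f y"
proof -
  have "\<exists>k p. p 0 = x \<and> p k = y \<and> (\<forall>j\<le>k. p j \<in> X) \<and> (\<forall>j<k. 0 < b (p j) (p (Suc j)))"
    using conn xy by (simp add: connected_graph_def)
  then obtain k p
    where p: "p 0 = x" "p k = y" "\<forall>j\<le>k. p j \<in> X" "\<forall>j<k. 0 < b (p j) (p (Suc j))"
    by (elim exE conjE)
  have "f (p j) = f x" if "j \<le> k" for j
    using that
  proof (induction j)
    case (Suc j)
    have "b (p j) (p (Suc j)) * (f (p j) - f (p (Suc j)))\<^sup>2 \<le> 0"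
      using edge_le_energy[OF f, of "p j" "p (Suc j)"] p(3) Suc.prems zero by simp
    moreover have "0 < b (p j) (p (Suc j))"
      using p(4) Suc.prems by simp
    ultimately have "f (p j) = f (p (Suc j))"
      by (simp add: mult_le_0_iff)
    then show ?case
      using Suc by simp
  qed (use p in simp)
  then show ?thesis
    using p(2) by force
qed

lemma r_dist_outside_ge:
  assumes f: "f \<in> finite_energy X b" and supp: "supp X f \<subseteq> \<Omega>"
    and pos: "0 < energy X b f" and y: "y \<in> X - \<Omega>"
  shows "ennreal ((f x)\<^sup>2 / energy X b f) \<le> r_dist X b \<Omega> x y"
proof -
  define e where "e = energy X b f"
  have e: "0 < e"
    using pos by (simp add: e_def)
  \<comment> \<open>The scaling factor enters the energy squared, as \<open>1 / e\<close>, which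
    normalises the energy to at most 1.\<close>
  define g where "g z = \<bar>f z\<bar> / sqrt e" for z
  have lip: "\<bar>g u - g v\<bar> \<le> 1 / sqrt e * \<bar>f u - f v\<bar>" for u v
  proof -
    have "\<bar>g u - g v\<bar> = \<bar>\<bar>f u\<bar> - \<bar>f v\<bar>\<bar> / sqrt e"
      using e by (simp add: g_def flip: diff_divide_distrib)
    also have "\<dots> \<le> \<bar>f u - f v\<bar> / sqrt e"
      using e by (intro divide_right_mono abs_triangle_ineq3) auto
    finally show ?thesis by simp
  qed
  have "energy X b g \<le> (1 / sqrt e)\<^sup>2 * energy X b f"
    using f lip by (rule finite_energy_contraction(2))
  then have "energy X b g \<le> 1"
    using e by (simp add: power_divide flip: e_def)
  moreover have "g \<in> finite_energy X b"
    using f lip by (rule finite_energy_contraction(1))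
  moreover have "supp X g \<subseteq> \<Omega>" "\<forall>z\<in>X. 0 \<le> g z"
    using supp e by (auto simp: supp_def g_def)
  ultimately have "ennreal (\<bar>g x - g y\<bar>\<^sup>2) \<le> r_dist X b \<Omega> x y"
    unfolding r_dist_def by (intro SUP_upper) auto
  moreover have "f y = 0"
    using y supp by (auto simp: supp_def)
  then have "\<bar>g x - g y\<bar>\<^sup>2 = (f x)\<^sup>2 / e"
    using e by (simp add: g_def power_divide)
  ultimately show ?thesis
    by (simp add: e_def)
qed

text \<open>A ball inside \<Omega> misses some vertex \<open>y\<close> outside \<Omega>, so its
  radius is at most the distance from its centre to \<open>y\<close>.\<close>

lemma inradius_le_pdiam:
  assumes "\<Omega> \<subset> X"
  shows "inradius X (r_dist X b \<Omega>) \<Omega> \<le> pdiam X (r_dist X b \<Omega>)"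
  unfolding inradius_def
proof (rule Sup_least, safe)
  fix s :: real and x
  assume x: "x \<in> \<Omega>" and ball: "pball X (r_dist X b \<Omega>) s x \<subseteq> \<Omega>"
  obtain y where y: "y \<in> X" "y \<notin> \<Omega>"
    using assms by auto
  then have "ennreal s \<le> r_dist X b \<Omega> x y"
    using ball by (force simp: pball_def)
  also have "\<dots> \<le> pdiam X (r_dist X b \<Omega>)"
    unfolding pdiam_def using x y(1) assms by (intro SUP_upper2[of x] SUP_upper) auto
  finally show "ennreal s \<le> pdiam X (r_dist X b \<Omega>)" .
qed

lemma pdiam_le_poincare_const:
  "pdiam X (r_dist X b \<Omega>) \<le> poincare_const X b \<Omega>"
  unfolding poincare_const_def
proof (rule Inf_greatest, safe)
  fix c :: real
  assume c: "0 \<le> c" and adm: "\<forall>f\<in>finite_energy X b. supp X f \<subseteq> \<Omega> \<longrightarrow>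
    (sup_norm X f)\<^sup>2 \<le> ennreal (c * energy X b f)"
  have "\<bar>f x - f y\<bar>\<^sup>2 \<le> c"
    if f: "f \<in> finite_energy X b" "\<forall>z\<in>X. 0 \<le> f z" "supp X f \<subseteq> \<Omega>" "energy X b f \<le> 1"
      and xy: "x \<in> X" "y \<in> X" for f x y
  proof -
    have "(sup_norm X f)\<^sup>2 \<le> ennreal (c * energy X b f)"
      using adm f by simp
    then have "(f z)\<^sup>2 \<le> c * energy X b f" if "z \<in> X" for z
      using c that by (simp add: sup_norm_power2_le_iff energy_nonneg)
    moreover have "c * energy X b f \<le> c"
      using c f(4) by (simp add: mult_left_le)
    \<comment> \<open>Nonnegativity bounds the difference by the larger value; the triangle
      inequality would cost a factor 4 after squaring.\<close>
    ultimately have "(max (f x) (f y))\<^sup>2 \<le> c"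
      using xy by (smt (verit) max_def)
    moreover have "\<bar>f x - f y\<bar>\<^sup>2 \<le> (max (f x) (f y))\<^sup>2"
      using f(2) xy by (intro power_mono) (auto simp: max_def abs_if)
    ultimately show ?thesis by linarith
  qed
  then show "pdiam X (r_dist X b \<Omega>) \<le> ennreal c"
    unfolding pdiam_def r_dist_def by (intro SUP_least ennreal_leI) auto
qed

lemma poincare_ineq_inradius:
  assumes conn: "connected_graph X b" and \<Omega>: "\<Omega> \<subset> X"
    and c: "inradius X (r_dist X b \<Omega>) \<Omega> \<le> ennreal c" "0 \<le> c"
    and f: "f \<in> finite_energy X b" and supp: "supp X f \<subseteq> \<Omega>"
  shows "(sup_norm X f)\<^sup>2 \<le> ennreal (c * energy X b f)"
proof -
  have "(f x)\<^sup>2 \<le> c * energy X b f" if x: "x \<in> X" for x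
  proof (cases "f x = 0")
    case True
    then show ?thesis
      using c energy_nonneg by simp
  next
    case False
    then have "x \<in> \<Omega>"
      using supp x by (auto simp: supp_def)
    obtain y where "y \<in> X" "y \<notin> \<Omega>"
      using \<Omega> by auto
    then have "f y = 0"
      using supp by (auto simp: supp_def)
    \<comment> \<open>Zero energy would make \<open>f\<close> constant, although it vanishes at
      \<open>y\<close> and not at \<open>x\<close>.\<close>
    then have pos: "0 < energy X b f"
      using False energy_zero_const[OF conn f _ x \<open>y \<in> X\<close>] energy_nonneg[of f]
      by (metis order_le_less)
    define s where "s = (f x)\<^sup>2 / energy X b f"
    \<comment> \<open>Every vertex outside \<Omega> has distance at least \<open>s\<close> from
      \<open>x\<close>, and the ball is open.\<close>
    have "pball X (r_dist X b \<Omega>) s x \<subseteq> \<Omega>"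
    proof
      fix z assume z: "z \<in> pball X (r_dist X b \<Omega>) s x"
      then have "z \<notin> X - \<Omega>"
        using r_dist_outside_ge[OF f supp pos, of z x] by (auto simp: pball_def s_def simp flip: not_le)
      then show "z \<in> \<Omega>"
        using z by (simp add: pball_def)
    qed
    moreover have "0 < s"
      using False pos by (simp add: s_def)
    ultimately have "ennreal s \<le> inradius X (r_dist X b \<Omega>) \<Omega>"
      unfolding inradius_def using \<open>x \<in> \<Omega>\<close> by (intro Sup_upper) auto
    also note c(1)
    finally have "s \<le> c"
      using c(2) by simp
    then show ?thesis
      using pos by (simp add: s_def pos_divide_le_eq)
  qed
  then show ?thesis
    using c(2) energy_nonneg by (simp add: sup_norm_power2_le_iff)
qed

lemma poincare_const_le_inradius:
  assumes "connected_graph X b" "\<Omega> \<subset> X"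
  shows "poincare_const X b \<Omega> \<le> inradius X (r_dist X b \<Omega>) \<Omega>"
proof (cases "inradius X (r_dist X b \<Omega>) \<Omega>")
  \<comment> \<open>A finite inradius is itself an admissible constant; an infinite one bounds
    everything.\<close>
  case (real c)
  then show ?thesis
    unfolding poincare_const_def
    using poincare_ineq_inradius[OF assms, of c] by (intro Inf_lower) auto
qed simp

end

theorem theorem5p2:
  fixes X :: "'v set" and b :: "'v \<Rightarrow> 'v \<Rightarrow> real" and \<Omega> :: "'v set"
  assumes "weighted_graph X b" and "connected_graph X b" and "\<Omega> \<subset> X"
  shows "poincare_const X b \<Omega> = inradius X (r_dist X b \<Omega>) \<Omega>
    \<and> inradius X (r_dist X b \<Omega>) \<Omega> = pdiam X (r_dist X b \<Omega>)
    \<and> ((\<exists>c::real. 0 < c \<and> (\<forall>f\<in>finite_energy X b. supp X f \<subseteq> \<Omega> \<longrightarrow>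
            (sup_norm X f)\<^sup>2 \<le> ennreal (c * energy X b f)))
        \<longleftrightarrow> inradius X (r_dist X b \<Omega>) \<Omega> < \<infinity>)"
    (is "?P = ?I \<and> ?I = ?D \<and> (?C \<longleftrightarrow> ?I < \<infinity>)")
proof (intro conjI)
  have "?I \<le> ?D" "?D \<le> ?P" "?P \<le> ?I"
    using inradius_le_pdiam[OF assms(1,3)] pdiam_le_poincare_const[OF assms(1)]
      poincare_const_le_inradius[OF assms] .
  then show PI: "?P = ?I" and "?I = ?D"
    by auto
  show "?C \<longleftrightarrow> ?I < \<infinity>"
  proof
    assume ?C
    then obtain c :: real where "0 < c" "\<forall>f\<in>finite_energy X b. supp X f \<subseteq> \<Omega> \<longrightarrow>
        (sup_norm X f)\<^sup>2 \<le> ennreal (c * energy X b f)"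
      by blast
    then have "?P \<le> ennreal c"
      unfolding poincare_const_def by (intro Inf_lower) auto
    then show "?I < \<infinity>"
      using PI by (simp add: order_le_less_trans)
  next
    assume "?I < \<infinity>"
    then obtain c where c: "0 \<le> c" "?I = ennreal c"
      by (cases ?I) auto
    \<comment> \<open>The inradius can be 0, for instance for empty \<Omega>, while the required
      constant must be strictly positive.\<close>
    then have "?I \<le> ennreal (c + 1)"
      by (simp add: ennreal_leI)
    then show ?C
      using poincare_ineq_inradius[OF assms, of "c + 1"] c(1) by (intro exI[of _ "c + 1"]) simp
  qed
qed

end
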